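(* Let $\mathbb{N}=A_1\cup\dots\cup A_r$ be a partition of $\mathbb{N}$ into finitely many classes. Then there is an index $i$ and elements $y\in A_i$ and $x_{n,j},z_{n,j}\in A_i$ (for all $n\in\mathbb{N}$ and $1\le j\le n$) such that for every $n\in\mathbb{N}$, $$x_{n,1}+x_{n,2}+\dots+x_{n,n}+2^n y=z_{n,1}+z_{n,2}+\dots+z_{n,n}.$$
   Context: $\mathbb{N}=\{1,2,3,\dots\}$. The values of distinct variables need not be distinct. *)

theory Defs
  imports Main "HOL-Library.Disjoint_Sets"
begin

end

theory Submission
  imports Defs "HOL-Library.Ramsey"
begin

text \<open>
  Call a set of naturals \<open>\<Delta>\<^sup>*\<close> if it meets the difference set of every infinite set; by Ramsey's
  theorem \<open>\<Delta>\<^sup>*\<close> sets are closed under finite intersections, and a greedy choice shows that they are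
  syndetic, hence not of density zero. If \<open>A\<close> does not have density zero, then for every \<open>c > 0\<close>
  the set \<open>{t. c t \<in> A - A}\<close> is \<open>\<Delta>\<^sup>*\<close>, because only boundedly many translates of \<open>A\<close> can be
  disjoint. As \<open>A - A\<close> is syndetic, the increasing sequence of \<open>n\<close>-fold sums \<open>n (A - A)\<close> is
  constant from some \<open>n = m(A)\<close> on, and its final value is a group.

  So the set of those \<open>y\<close> such that \<open>2\<^sup>n y \<in> A\<^sub>i - A\<^sub>i\<close> for all classes \<open>A\<^sub>i\<close> not of density zero
  and all \<open>1 \<le> n \<le> m(A\<^sub>i) + 1\<close> is \<open>\<Delta>\<^sup>*\<close>, and it must meet a class \<open>A\<^sub>i\<close> not of density zero. A
  common \<open>y\<close> solves the equations for small \<open>n\<close> directly, and those for large \<open>n\<close> since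
  \<open>2\<^sup>n y\<close> is a multiple of \<open>2 y \<in> A\<^sub>i - A\<^sub>i\<close> and so lies in the group.
\<close>

section \<open>Sets of density zero\<close>

text \<open>The limit of the counting function divided by \<open>T\<close> is zero, stated without division.\<close>

definition density_zero :: "nat set \<Rightarrow> bool" where
  "density_zero Z \<longleftrightarrow> (\<forall>k. \<exists>T0. \<forall>T\<ge>T0. k * card (Z \<inter> {..<T}) \<le> T)"

lemma density_zero_mono:
  assumes "density_zero Z" "Y \<subseteq> Z"
  shows "density_zero Y"
  unfolding density_zero_def
proof
  fix k
  obtain T0 where T0: "\<And>T. T \<ge> T0 \<Longrightarrow> k * card (Z \<inter> {..<T}) \<le> T"
    using assms(1) unfolding density_zero_def by blast
  have "k * card (Y \<inter> {..<T}) \<le> k * card (Z \<inter> {..<T})" for T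
    using assms(2) by (intro mult_le_mono2 card_mono) auto
  then show "\<exists>T0. \<forall>T\<ge>T0. k * card (Y \<inter> {..<T}) \<le> T"
    using T0 le_trans by blast
qed

lemma density_zero_finite:
  assumes "finite Z"
  shows "density_zero Z"
  unfolding density_zero_def
proof
  fix k
  have "k * card (Z \<inter> {..<T}) \<le> k * card Z" for T
    using assms by (intro mult_le_mono2 card_mono) auto
  then show "\<exists>T0. \<forall>T\<ge>T0. k * card (Z \<inter> {..<T}) \<le> T"
    using le_trans by blast
qed

lemma density_zero_Un:
  assumes "density_zero Y" "density_zero Z"
  shows "density_zero (Y \<union> Z)"
  unfolding density_zero_def
proof
  fix k
  \<comment> \<open>Doubling \<open>k\<close> lets each of the two sets use up only half of
    \<open>T\<close>.\<close>
  obtain T1 where T1: "\<And>T. T \<ge> T1 \<Longrightarrow> (2 * k) * card (Y \<inter> {..<T}) \<le> T"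
    using assms(1) unfolding density_zero_def by blast
  obtain T2 where T2: "\<And>T. T \<ge> T2 \<Longrightarrow> (2 * k) * card (Z \<inter> {..<T}) \<le> T"
    using assms(2) unfolding density_zero_def by blast
  have "k * card ((Y \<union> Z) \<inter> {..<T}) \<le> T" if "T \<ge> max T1 T2" for T
  proof -
    have "card ((Y \<union> Z) \<inter> {..<T}) \<le> card (Y \<inter> {..<T}) + card (Z \<inter> {..<T})"
      by (simp add: Int_Un_distrib2 card_Un_le)
    then have "k * card ((Y \<union> Z) \<inter> {..<T}) \<le> k * (card (Y \<inter> {..<T}) + card (Z \<inter> {..<T}))"
      by (rule mult_le_mono2)
    then show ?thesis
      using T1[of T] T2[of T] that by (simp add: algebra_simps)
  qed
  then show "\<exists>T0. \<forall>T\<ge>T0. k * card ((Y \<union> Z) \<inter> {..<T}) \<le> T" by blast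
qed

lemma density_zero_UN:
  assumes "finite I" "\<And>i. i \<in> I \<Longrightarrow> density_zero (Z i)"
  shows "density_zero (\<Union>i\<in>I. Z i)"
  using assms by induction (simp_all add: density_zero_finite density_zero_Un)

lemma density_zero_translate:
  assumes "density_zero Z"
  shows "density_zero ((\<lambda>a. a + f) ` Z)"
  unfolding density_zero_def
proof
  fix k
  obtain T0 where T0: "\<And>T. T \<ge> T0 \<Longrightarrow> k * card (Z \<inter> {..<T}) \<le> T"
    using assms unfolding density_zero_def by blast
  have "card ((\<lambda>a. a + f) ` Z \<inter> {..<T}) \<le> card (Z \<inter> {..<T})" for T
    by (rule surj_card_le[where f = "\<lambda>a. a + f"]) auto
  then have "k * card ((\<lambda>a. a + f) ` Z \<inter> {..<T}) \<le> k * card (Z \<inter> {..<T})" for T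
    by (rule mult_le_mono2)
  then show "\<exists>T0. \<forall>T\<ge>T0. k * card ((\<lambda>a. a + f) ` Z \<inter> {..<T}) \<le> T"
    using T0 le_trans by blast
qed

lemma not_density_zero_atLeast: "\<not> density_zero {N..}"
proof
  assume "density_zero {N..}"
  then obtain T0 where "\<And>T. T \<ge> T0 \<Longrightarrow> 2 * card ({N..} \<inter> {..<T}) \<le> T"
    unfolding density_zero_def by blast
  \<comment> \<open>Beyond \<open>2 * N\<close> more than half of the numbers below \<open>T\<close>
    are at least \<open>N\<close>.\<close>
  from this[of "max T0 (2 * N + 1)"] show False
    by (simp flip: atLeastLessThan_def)
qed

section \<open>Sets meeting all difference sets\<close>

definition delta_star :: "nat set \<Rightarrow> bool" where
  "delta_star R \<longleftrightarrow> (\<forall>X. infinite X \<longrightarrow> (\<exists>x\<in>X. \<exists>y\<in>X. x < y \<and> y - x \<in> R))"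

lemma delta_star_UNIV: "delta_star UNIV"
  unfolding delta_star_def
proof (intro allI impI)
  fix X :: "nat set"
  assume X: "infinite X"
  then obtain x where "x \<in> X"
    using infinite_imp_nonempty by blast
  moreover obtain y where "y \<in> X" "x < y"
    using X unfolding infinite_nat_iff_unbounded by blast
  ultimately show "\<exists>x\<in>X. \<exists>y\<in>X. x < y \<and> y - x \<in> UNIV" by blast
qed

lemma delta_star_Int:
  assumes R: "delta_star R" and R': "delta_star R'"
  shows "delta_star (R \<inter> R')"
  unfolding delta_star_def
proof (intro allI impI)
  fix X :: "nat set"
  assume X: "infinite X"
  \<comment> \<open>Colours a pair by whether its difference lies in \<open>R\<close>;
    \<open>Max\<close> and \<open>Min\<close> recover the difference from the unordered
    pair.\<close>
  define f where "f e = (if Max e - Min e \<in> R then 0 else 1 :: nat)" for e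
  have "\<forall>x\<in>X. \<forall>y\<in>X. x \<noteq> y \<longrightarrow> f {x, y} < 2"
    by (simp add: f_def)
  from Ramsey2[OF X this] obtain Y t where Y: "Y \<subseteq> X" "infinite Y"
    "\<forall>x\<in>Y. \<forall>y\<in>Y. x \<noteq> y \<longrightarrow> f {x, y} = t"
    by metis
  have f: "f {x, y} = 0 \<longleftrightarrow> y - x \<in> R" if "x < y" for x y
    using that by (simp add: f_def max_def min_def)
  \<comment> \<open>\<open>R\<close> meets the differences of the homogeneous set \<open>Y\<close>,
    which forces colour 0. All differences of \<open>Y\<close> then lie in \<open>R\<close>, so any
    one that \<open>R'\<close> supplies will do.\<close>
  obtain x y where "x \<in> Y" "y \<in> Y" "x < y" "y - x \<in> R"
    using R Y(2) unfolding delta_star_def by blast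
  then have "t = 0" using f Y(3) by (metis less_irrefl)
  obtain x y where xy: "x \<in> Y" "y \<in> Y" "x < y" "y - x \<in> R'"
    using R' Y(2) unfolding delta_star_def by blast
  then have "y - x \<in> R" using f Y(3) \<open>t = 0\<close> by (metis less_irrefl)
  with xy Y(1) show "\<exists>x\<in>X. \<exists>y\<in>X. x < y \<and> y - x \<in> R \<inter> R'" by blast
qed

lemma delta_star_INT:
  assumes "finite I" "\<And>i. i \<in> I \<Longrightarrow> delta_star (R i)"
  shows "delta_star (\<Inter>i\<in>I. R i)"
  using assms by induction (simp_all add: delta_star_UNIV delta_star_Int)

text \<open>If no finite \<open>F\<close> worked, one could choose greedily, one point after
  another, an infinite set whose differences all avoid \<open>R\<close>.\<close>

lemma delta_star_syndetic:
  assumes "delta_star R"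
  obtains F N where "finite F" "\<And>s. s \<ge> N \<Longrightarrow> \<exists>f\<in>F. f < s \<and> s - f \<in> R"
proof (rule ccontr)
  assume contra: "\<not> thesis"
  note conclude = that
  have ext: "\<exists>s. \<forall>f\<in>F. f < s \<and> s - f \<notin> R" if F: "finite F" for F
  proof -
    \<comment> \<open>A bound beyond all of \<open>F\<close> ensures \<open>f < s\<close>, so the
      only way to fail is \<open>s - f \<notin> R\<close>.\<close>
    obtain s where s: "s \<ge> Suc (Max (insert 0 F))" "\<not> (\<exists>f\<in>F. f < s \<and> s - f \<in> R)"
      using contra conclude[OF F, of "Suc (Max (insert 0 F))"] by blast
    have "f < s" if "f \<in> F" for f
      using s(1) F that by (meson Max_ge finite_insert insertI2 le_imp_less_Suc less_le_trans)
    with s(2) show ?thesis by blast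
  qed
  have "\<exists>h::nat \<Rightarrow> nat. \<forall>n. \<forall>i<n. h i < h n \<and> h n - h i \<notin> R"
  proof (rule dependent_wf_choice[where R = less_than and
        P = "\<lambda>h n s. \<forall>i<n. h i < s \<and> s - h i \<notin> R"])
    fix n :: nat and h :: "nat \<Rightarrow> nat"
    show "\<exists>s. \<forall>i<n. h i < s \<and> s - h i \<notin> R"
      using ext[of "h ` {..<n}"] by auto
  qed auto
  then obtain h :: "nat \<Rightarrow> nat" where h: "\<And>i n. i < n \<Longrightarrow> h i < h n \<and> h n - h i \<notin> R"
    by blast
  then have mono: "strict_mono h" by (auto simp: strict_mono_def)
  then have "infinite (range h)"
    by (simp add: range_inj_infinite strict_mono_imp_inj_on)
  then obtain i j where "h i < h j" "h j - h i \<in> R"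
    using assms unfolding delta_star_def by blast
  with h mono show False by (simp add: strict_mono_less)
qed

text \<open>By syndeticity finitely many translates of \<open>R\<close> cover a ray, and finite
  unions of translates preserve density zero.\<close>

lemma delta_star_not_density_zero:
  assumes "delta_star R"
  shows "\<not> density_zero R"
proof
  assume "density_zero R"
  obtain F N where FN: "finite F" "\<And>s. s \<ge> N \<Longrightarrow> \<exists>f\<in>F. f < s \<and> s - f \<in> R"
    using delta_star_syndetic[OF assms] by metis
  have "{N..} \<subseteq> (\<Union>f\<in>F. (\<lambda>a. a + f) ` R)"
  proof
    fix s assume "s \<in> {N..}"
    then obtain f where "f \<in> F" "f < s" "s - f \<in> R" using FN(2) by auto
    moreover from this have "s = (s - f) + f" by simp
    ultimately show "s \<in> (\<Union>f\<in>F. (\<lambda>a. a + f) ` R)" by blast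
  qed
  moreover have "density_zero (\<Union>f\<in>F. (\<lambda>a. a + f) ` R)"
    using FN(1) \<open>density_zero R\<close> by (simp add: density_zero_UN density_zero_translate)
  ultimately show False
    using density_zero_mono not_density_zero_atLeast by blast
qed

text \<open>If \<open>X\<close> were a counterexample, the translates of \<open>A\<close> by
  \<open>c * x\<close> for \<open>x \<in> X\<close> would be pairwise disjoint, and too many of them
  cannot fit into an initial segment.\<close>

lemma delta_star_differences:
  assumes A: "\<not> density_zero A" and "c > 0"
  shows "delta_star {t. \<exists>a\<in>A. \<exists>b\<in>A. c * t + a = b}"
  unfolding delta_star_def
proof (intro allI impI, rule ccontr)
  fix X :: "nat set"
  assume X: "infinite X"
    and "\<not> (\<exists>x\<in>X. \<exists>y\<in>X. x < y \<and> y - x \<in> {t. \<exists>a\<in>A. \<exists>b\<in>A. c * t + a = b})"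
  then have no: "c * (y - x) + a \<noteq> b" if "x \<in> X" "y \<in> X" "x < y" "a \<in> A" "b \<in> A" for x y a b
    using that by blast
  have less: "a + c * y \<noteq> b + c * x" if "x \<in> X" "y \<in> X" "x < y" "a \<in> A" "b \<in> A" for x y a b
    using no[OF that] \<open>x < y\<close> by (auto simp: diff_mult_distrib2)
  have disj: "a + c * y \<noteq> b + c * x" if "x \<in> X" "y \<in> X" "x \<noteq> y" "a \<in> A" "b \<in> A" for x y a b
    using less[of x y a b] less[of y x b a] that by (metis linorder_neqE_nat)
  obtain k where k: "\<And>T0. \<exists>T\<ge>T0. T < k * card (A \<inter> {..<T})"
    using A unfolding density_zero_def by (meson not_le)
  \<comment> \<open>Each of the \<open>2 * k\<close> translates will have more than
    \<open>T / k\<close> points, so more than \<open>2 * T\<close> in total, all below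
    \<open>T + M\<close>; choosing \<open>T \<ge> M\<close> makes this impossible.\<close>
  obtain F where F: "finite F" "card F = 2 * k" "F \<subseteq> X"
    using infinite_arbitrarily_large[OF X] by blast
  define M where "M = Max (insert 0 ((*) c ` F))"
  have M: "c * x \<le> M" if "x \<in> F" for x
    unfolding M_def using that F(1) by (intro Max_ge) auto
  obtain T where T: "T \<ge> M" "T < k * card (A \<inter> {..<T})"
    using k by blast
  define B where "B x = (\<lambda>a. a + c * x) ` (A \<inter> {..<T})" for x
  have "card (B x) = card (A \<inter> {..<T})" for x
    unfolding B_def by (rule card_image) (simp add: inj_on_def)
  moreover have "card (\<Union>x\<in>F. B x) = (\<Sum>x\<in>F. card (B x))"
  proof (rule card_UN_disjoint)
    show "\<forall>x\<in>F. \<forall>y\<in>F. x \<noteq> y \<longrightarrow> B x \<inter> B y = {}"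
      using disj F(3) unfolding B_def by blast
  qed (use F(1) in \<open>simp_all add: B_def\<close>)
  moreover have "(\<Union>x\<in>F. B x) \<subseteq> {..<T + M}"
    using M by (auto simp: B_def intro: add_less_le_mono)
  then have "card (\<Union>x\<in>F. B x) \<le> T + M"
    by (metis card_lessThan card_mono finite_lessThan)
  ultimately have "2 * (k * card (A \<inter> {..<T})) \<le> T + M"
    using F(2) by simp
  with T show False by linarith
qed

section \<open>Iterated difference sets\<close>

text \<open>The \<open>n\<close>-fold sumset of \<open>A - A\<close>, taken in the integers to make
  it symmetric about 0.\<close>

primrec diff_sums :: "nat set \<Rightarrow> nat \<Rightarrow> int set" where
  "diff_sums A 0 = {0}"
| "diff_sums A (Suc n) = {s + (int b - int a) |s a b. s \<in> diff_sums A n \<and> a \<in> A \<and> b \<in> A}"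

lemma diff_sums_add:
  assumes "s \<in> diff_sums A m" "t \<in> diff_sums A n"
  shows "s + t \<in> diff_sums A (m + n)"
  using assms(2)
proof (induction n arbitrary: t)
  case (Suc n)
  then obtain u a b where "t = u + (int b - int a)" "u \<in> diff_sums A n" "a \<in> A" "b \<in> A"
    by auto
  moreover from this have "s + u \<in> diff_sums A (m + n)" using Suc.IH by blast
  moreover have "s + t = (s + u) + (int b - int a)" using calculation by simp
  ultimately show ?case unfolding add_Suc_right diff_sums.simps by blast
qed (use assms(1) in simp)

lemma diff_sums_uminus: "s \<in> diff_sums A n \<Longrightarrow> - s \<in> diff_sums A n"
proof (induction n arbitrary: s)
  case (Suc n)
  then obtain u a b where "s = u + (int b - int a)" "u \<in> diff_sums A n" "a \<in> A" "b \<in> A"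
    by auto
  moreover from this have "- u \<in> diff_sums A n" using Suc.IH by blast
  moreover have "- s = - u + (int a - int b)" using calculation by simp
  ultimately show ?case unfolding diff_sums.simps by blast
qed simp

lemma diff_sums_one: "int d \<in> diff_sums A 1 \<longleftrightarrow> (\<exists>a\<in>A. \<exists>b\<in>A. d + a = b)"
proof -
  have "int d = int b - int a \<longleftrightarrow> d + a = b" for a b by linarith
  then show ?thesis by auto
qed

text \<open>Sums are padded with zero summands \<open>a - a\<close>, for which \<open>A\<close> has
  to contain some \<open>a\<close>.\<close>

lemma diff_sums_mono:
  assumes "m \<le> n" "A \<noteq> {}"
  shows "diff_sums A m \<subseteq> diff_sums A n"
proof -
  have "diff_sums A n \<subseteq> diff_sums A (Suc n)" for n
    using assms(2) by force
  then show ?thesis using assms(1) by (rule lift_Suc_mono_le)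
qed

lemma diff_sums_mult: "s \<in> diff_sums A n \<Longrightarrow> int k * s \<in> diff_sums A (k * n)"
  by (induction k) (simp_all add: diff_sums_add algebra_simps)

text \<open>Collecting the subtracted terms in \<open>x\<close> and the added ones in
  \<open>z\<close> gives the shape of the desired equation.\<close>

lemma diff_sums_representation:
  assumes "s \<in> diff_sums A n"
  obtains x z :: "nat \<Rightarrow> nat" where
    "\<And>j. j \<in> {1..n} \<Longrightarrow> x j \<in> A \<and> z j \<in> A"
    "(\<Sum>j=1..n. int (x j)) + s = (\<Sum>j=1..n. int (z j))"
  using assms
proof (induction n arbitrary: s thesis)
  case (Suc n)
  from Suc.prems(2) obtain u a b where
    s: "s = u + (int b - int a)" "u \<in> diff_sums A n" "a \<in> A" "b \<in> A"
    by auto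
  obtain x z :: "nat \<Rightarrow> nat" where xz: "\<And>j. j \<in> {1..n} \<Longrightarrow> x j \<in> A \<and> z j \<in> A"
    "(\<Sum>j=1..n. int (x j)) + u = (\<Sum>j=1..n. int (z j))"
    using Suc.IH[OF _ s(2)] by blast
  show ?case
  proof (rule Suc.prems(1)[of "x(Suc n := a)" "z(Suc n := b)"])
    show "(x(Suc n := a)) j \<in> A \<and> (z(Suc n := b)) j \<in> A" if "j \<in> {1..Suc n}" for j
      using that xz(1) s by (auto simp: le_Suc_eq)
    show "(\<Sum>j=1..Suc n. int ((x(Suc n := a)) j)) + s = (\<Sum>j=1..Suc n. int ((z(Suc n := b)) j))"
      using xz(2) s by simp
  qed
qed auto

text \<open>Up to one summand from \<open>A - A\<close>, every nonnegative element of any level is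
  one of finitely many numbers, for which a common level exists.\<close>

lemma diff_sums_stabilize:
  assumes A: "\<not> density_zero A"
  obtains m where "\<And>n. diff_sums A n \<subseteq> diff_sums A m"
proof -
  have "A \<noteq> {}" using A density_zero_finite by blast
  note mono = diff_sums_mono[OF _ this]
  obtain F N where FN: "finite F"
    "\<And>s. s \<ge> N \<Longrightarrow> \<exists>f\<in>F. f < s \<and> s - f \<in> {t. \<exists>a\<in>A. \<exists>b\<in>A. 1 * t + a = b}"
    by (rule delta_star_syndetic[OF delta_star_differences[OF A zero_less_one]], rule that)
  \<comment> \<open>Only the candidates reached at some level matter; as there are finitely many,
    the maximum of their levels serves for all.\<close>
  define H where "H = {h \<in> F \<union> {..<N}. \<exists>n. int h \<in> diff_sums A n}"
  have "finite H" using FN(1) by (simp add: H_def)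
  have "\<forall>h\<in>H. \<exists>n. int h \<in> diff_sums A n"
    unfolding H_def by blast
  then obtain \<nu> where \<nu>: "\<And>h. h \<in> H \<Longrightarrow> int h \<in> diff_sums A (\<nu> h)"
    by metis
  define m where "m = Max (insert 0 (\<nu> ` H))"
  have H: "int h \<in> diff_sums A m" if "h \<in> H" for h
    using \<nu>[OF that] mono[of "\<nu> h" m] that \<open>finite H\<close> by (auto simp: m_def)
  have nonneg: "int s \<in> diff_sums A (m + 1)" if s: "int s \<in> diff_sums A n" for s n
  proof (cases "s < N")
    case True
    then have "s \<in> H" using s by (auto simp: H_def)
    then show ?thesis using H mono[OF le_add1] by blast
  next
    case False
    then obtain f where f: "f \<in> F" "f < s" "\<exists>a\<in>A. \<exists>b\<in>A. (s - f) + a = b"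
      using FN(2)[of s] unfolding not_less mem_Collect_eq mult_1 by blast
    then have d: "int (s - f) \<in> diff_sums A 1" by (simp only: diff_sums_one)
    \<comment> \<open>This level depends on \<open>n\<close>, but it serves only to put
      \<open>f\<close> into \<open>H\<close>, which brings it down to level
      \<open>m\<close>.\<close>
    have "int s + - int (s - f) \<in> diff_sums A (n + 1)"
      using s d by (intro diff_sums_add diff_sums_uminus)
    then have "int f \<in> diff_sums A (n + 1)" using f(2) by (simp add: of_nat_diff)
    then have "f \<in> H" using f(1) unfolding H_def by blast
    then have "int f + int (s - f) \<in> diff_sums A (m + 1)"
      using H d by (intro diff_sums_add)
    then show ?thesis using f(2) by (simp add: of_nat_diff)
  qed
  have "s \<in> diff_sums A (m + 1)" if s: "s \<in> diff_sums A n" for s n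
  proof (cases "s \<ge> 0")
    case True
    then show ?thesis using nonneg[of "nat s" n] s by (simp del: diff_sums.simps)
  next
    case False
    then have "- s \<in> diff_sums A (m + 1)"
      using nonneg[of "nat (- s)" n] diff_sums_uminus[OF s] by (simp del: diff_sums.simps)
    from diff_sums_uminus[OF this] show ?thesis by simp
  qed
  then show thesis using that by blast
qed

section \<open>Choice of the class and solution of the equations\<close>

theorem theorem2p3:
  fixes A :: "nat \<Rightarrow> nat set" and r :: nat
  assumes cover: "(\<Union>i\<in>{1..r}. A i) = {1..}"
    and disjoint: "disjoint_family_on A {1..r}"
  shows "\<exists>i\<in>{1..r}. \<exists>y\<in>A i. \<exists>(x :: nat \<Rightarrow> nat \<Rightarrow> nat) (z :: nat \<Rightarrow> nat \<Rightarrow> nat).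
           (\<forall>n\<ge>1. \<forall>j\<in>{1..n}. x n j \<in> A i \<and> z n j \<in> A i) \<and>
           (\<forall>n\<ge>1. (\<Sum>j=1..n. x n j) + 2 ^ n * y = (\<Sum>j=1..n. z n j))"
proof -
  define L where "L = {i \<in> {1..r}. \<not> density_zero (A i)}"
  have "\<exists>m. \<forall>n. diff_sums (A i) n \<subseteq> diff_sums (A i) m" if "i \<in> L" for i
    using diff_sums_stabilize[of "A i"] that unfolding L_def by blast
  then obtain m where m: "\<And>i n. i \<in> L \<Longrightarrow> diff_sums (A i) n \<subseteq> diff_sums (A i) (m i)"
    by metis
  \<comment> \<open>The bound \<open>Suc (m i)\<close> keeps \<open>n = 1\<close> in the range even
    if \<open>m i = 0\<close>; the large exponents rely on it.\<close>
  define R where "R = (\<Inter>i\<in>L. \<Inter>n\<in>{1..Suc (m i)}. {t. \<exists>a\<in>A i. \<exists>b\<in>A i. 2 ^ n * t + a = b})"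
  have "delta_star R"
    unfolding R_def by (intro delta_star_INT delta_star_differences) (auto simp: L_def)
  define Z where "Z = (\<Union>i\<in>{1..r} - L. A i)"
  have "density_zero Z"
    unfolding Z_def by (rule density_zero_UN) (auto simp: L_def)
  moreover have "density_zero {0}"
    by (simp add: density_zero_finite)
  \<comment> \<open>The point 0 lies in no class and \<open>Z\<close> collects the classes of
    density zero, so an element of \<open>R\<close> outside both lies in a class indexed by
    \<open>L\<close>.\<close>
  ultimately have "\<not> R \<subseteq> {0} \<union> Z"
    using delta_star_not_density_zero[OF \<open>delta_star R\<close>] density_zero_mono density_zero_Un by blast
  then obtain y where y: "y \<in> R" "y \<in> {1..}" "y \<notin> Z" by force
  then obtain i where i: "i \<in> {1..r}" "y \<in> A i" using cover by blast
  with y(3) have "i \<in> L" by (auto simp: Z_def)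
  have small: "int (2 ^ n * y) \<in> diff_sums (A i) 1" if "n \<in> {1..Suc (m i)}" for n
    using y(1) \<open>i \<in> L\<close> that unfolding R_def diff_sums_one by blast
  have large: "int (2 ^ n * y) \<in> diff_sums (A i) n" if "n \<ge> 1" for n
  proof (cases "n \<le> Suc (m i)")
    case True
    then show ?thesis
      using small[of n] diff_sums_mono[of 1 n "A i"] that i(2) by auto
  next
    case False
    \<comment> \<open>As a multiple of \<open>2 * y\<close>, the number is reached at level
      \<open>2 ^ (n - 1)\<close>; stabilization lowers this to \<open>m i\<close>, and monotonicity
      then gives level \<open>n\<close>.\<close>
    have "int (2 ^ (n - 1)) * int (2 ^ 1 * y) \<in> diff_sums (A i) (2 ^ (n - 1) * 1)"
      using small[of 1] by (intro diff_sums_mult) simp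
    also have "int (2 ^ (n - 1)) * int (2 ^ 1 * y) = int (2 ^ n * y)"
      using that by (cases n) simp_all
    finally show ?thesis
      using m[OF \<open>i \<in> L\<close>] diff_sums_mono[of "m i" n "A i"] False i(2) by fastforce
  qed
  have "\<exists>x z :: nat \<Rightarrow> nat. (\<forall>j\<in>{1..n}. x j \<in> A i \<and> z j \<in> A i) \<and>
      (\<Sum>j=1..n. x j) + 2 ^ n * y = (\<Sum>j=1..n. z j)" if "n \<ge> 1" for n
  proof -
    obtain x z :: "nat \<Rightarrow> nat" where xz: "\<And>j. j \<in> {1..n} \<Longrightarrow> x j \<in> A i \<and> z j \<in> A i"
      "(\<Sum>j=1..n. int (x j)) + int (2 ^ n * y) = (\<Sum>j=1..n. int (z j))"
      by (rule diff_sums_representation[OF large[OF \<open>n \<ge> 1\<close>]], rule that)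
    from xz(2) have "int ((\<Sum>j=1..n. x j) + 2 ^ n * y) = int (\<Sum>j=1..n. z j)"
      by simp
    with xz(1) show ?thesis by (metis of_nat_eq_iff)
  qed
  then have "\<exists>x z :: nat \<Rightarrow> nat \<Rightarrow> nat. \<forall>n\<ge>1. (\<forall>j\<in>{1..n}. x n j \<in> A i \<and> z n j \<in> A i) \<and>
      (\<Sum>j=1..n. x n j) + 2 ^ n * y = (\<Sum>j=1..n. z n j)"
    by metis
  with i show ?thesis by blast
qed

end
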